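(* For $N\ge 1$ let $K_{2,N}$ be the complete bipartite graph with $2+N$ vertices, where vertices $1,2$ form one part and vertices $3,\dots,N+2$ form the other. For each $k\in\mathbb{N}$ there is a constant $C(k)\in\mathbb{N}$ such that for all $N\ge 1$ and all $d\in\mathbb{Z}_{\ge 2}^{N+2}$ with $d_1=2$ and $d_2=k$, $$\operatorname{mardeg}(\mathcal{B}_{K_{2,N},d})\le C(k).$$
   Context: $\mathbb{N}=\{0,1,\dots\}$. For a simplicial complex $\Gamma$ on vertex set $V$ (a graph is viewed as a one-dimensional simplicial complex) and $d\in\mathbb{Z}_{\ge 2}^V$, let $D_F=\prod_{j\in F}[d_j]$ for $F\subseteq V$ and for $i\in D_V$ let $i_F=(i_j)_{j\in F}$. $\mathcal{B}_{\Gamma,d}$ is the matrix with one column $b_i=\bigoplus_{F\text{ facet of }\Gamma}e_{i_F}\in\bigoplus_{F}\mathbb{Z}^{D_F}$ for each $i\in D_V$; i.e. it maps a table in $\mathbb{Z}^{D_V}$ to its $F$-marginals over all facets $F$ of $\Gamma$ (for $K_{2,N}$ the facets are the edges $\{1,j\},\{2,j\}$, $j=3,\dots,N+2$). A Markov basis of a matrix $M$ with $n$ columns is a set $\mathcal{M}\subseteq\mathbb{Z}^n$ such that for every integer vector $b$ the undirected graph on $\{v\in\mathbb{N}^n:Mv=b\}$, in which $u,v$ are adjacent iff $u-v\in\pm\mathcal{M}$, is connected. For $v=v^+-v^-$ (positive and negative part), $\deg(v)=\max\{\|v^+\|_1,\|v^-\|_1\}$, $\deg(\mathcal{M})=\sup_{v\in\mathcal{M}}\deg(v)$,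 and $\operatorname{mardeg}(M)$ is the minimum of $\deg(\mathcal{M})$ over all Markov bases $\mathcal{M}$ of $M$. *)

theory Defs
  imports Main "HOL-Library.FuncSet" "HOL-Library.Extended_Nat"
begin

section \<open>Markov bases of integer matrices\<close>

text \<open>The rows and columns of a matrix are indexed by arbitrary (finite) sets, and only
  the entries at these indices matter.\<close>

record ('r, 'c) int_matrix =
  rows :: "'r set"
  cols :: "'c set"
  entry :: "'r \<Rightarrow> 'c \<Rightarrow> int"

text \<open>The lattice \<open>\<int>\<^sup>I\<close>: functions extended by zero outside \<open>I\<close>, so that equality of
  vectors is equality of functions.\<close>

definition int_vectors :: "'i set \<Rightarrow> ('i \<Rightarrow> int) set" where
  "int_vectors I = {v. \<forall>i. i \<notin> I \<longrightarrow> v i = 0}"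

definition nonneg_vectors :: "'i set \<Rightarrow> ('i \<Rightarrow> int) set" where
  "nonneg_vectors I = {v \<in> int_vectors I. \<forall>i\<in>I. 0 \<le> v i}"

definition mat_apply :: "('r, 'c) int_matrix \<Rightarrow> ('c \<Rightarrow> int) \<Rightarrow> 'r \<Rightarrow> int" where
  "mat_apply M v = (\<lambda>r. if r \<in> rows M then (\<Sum>c\<in>cols M. entry M r c * v c) else 0)"

definition fiber :: "('r, 'c) int_matrix \<Rightarrow> ('r \<Rightarrow> int) \<Rightarrow> ('c \<Rightarrow> int) set" where
  "fiber M b = {v \<in> nonneg_vectors (cols M). mat_apply M v = b}"

definition fiber_graph ::
    "('r, 'c) int_matrix \<Rightarrow> ('c \<Rightarrow> int) set \<Rightarrow> ('r \<Rightarrow> int) \<Rightarrow> (('c \<Rightarrow> int) \<times> ('c \<Rightarrow> int)) set" where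
  "fiber_graph M B b = {(u, v). u \<in> fiber M b \<and> v \<in> fiber M b \<and>
     ((\<lambda>c. u c - v c) \<in> B \<or> (\<lambda>c. v c - u c) \<in> B)}"

text \<open>The graph on an empty fiber counts as connected.\<close>

definition markov_basis :: "('r, 'c) int_matrix \<Rightarrow> ('c \<Rightarrow> int) set \<Rightarrow> bool" where
  "markov_basis M B \<longleftrightarrow> B \<subseteq> int_vectors (cols M) \<and>
     (\<forall>b \<in> int_vectors (rows M). \<forall>u \<in> fiber M b. \<forall>v \<in> fiber M b.
        (u, v) \<in> (fiber_graph M B b)\<^sup>*)"

definition norm1 :: "'i set \<Rightarrow> ('i \<Rightarrow> int) \<Rightarrow> nat" where
  "norm1 I v = (\<Sum>i\<in>I. nat \<bar>v i\<bar>)"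

definition vec_degree :: "'i set \<Rightarrow> ('i \<Rightarrow> int) \<Rightarrow> nat" where
  "vec_degree I v = max (norm1 I (\<lambda>i. max (v i) 0)) (norm1 I (\<lambda>i. max (- v i) 0))"

text \<open>Degrees of sets are extended naturals; the empty set has degree \<open>0\<close>.\<close>

definition set_degree :: "'i set \<Rightarrow> ('i \<Rightarrow> int) set \<Rightarrow> enat" where
  "set_degree I B = (SUP v\<in>B. enat (vec_degree I v))"

definition mardeg :: "('r, 'c) int_matrix \<Rightarrow> enat" where
  "mardeg M = (INF B\<in>{B. markov_basis M B}. set_degree (cols M) B)"

text \<open>Markov bases always exist, so the infimum is a minimum.\<close>

lemma markov_basis_int_vectors: "markov_basis M (int_vectors (cols M))"
  by (auto simp: markov_basis_def fiber_graph_def fiber_def nonneg_vectors_def int_vectors_def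
      intro!: r_into_rtrancl)

lemma mardeg_attained: "\<exists>B. markov_basis M B \<and> set_degree (cols M) B = mardeg M"
proof -
  let ?S = "set_degree (cols M) ` {B. markov_basis M B}"
  have "set_degree (cols M) (int_vectors (cols M)) \<in> ?S"
    using markov_basis_int_vectors[of M] by simp
  then have "Inf ?S \<in> ?S"
    by (rule wellorder_InfI)
  then show ?thesis
    by (auto simp: mardeg_def)
qed


section \<open>Matrices of hierarchical models\<close>

definition facets :: "'v set set \<Rightarrow> 'v set set" where
  "facets \<Gamma> = {F \<in> \<Gamma>. \<forall>G\<in>\<Gamma>. F \<subseteq> G \<longrightarrow> F = G}"

definition multi_indices :: "('v \<Rightarrow> nat) \<Rightarrow> 'v set \<Rightarrow> ('v \<Rightarrow> nat) set" where
  "multi_indices d F = (\<Pi>\<^sub>E j\<in>F. {1..d j})"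

text \<open>The matrix \<open>\<B>\<^bsub>\<Gamma>,d\<^esub>\<close> for a simplicial complex \<open>\<Gamma>\<close> on \<open>V\<close>. Its rows are indexed by the
  disjoint union of the sets \<open>D\<^sub>F\<close> over all facets \<open>F\<close>; \<open>restrict i F\<close> is the subtuple \<open>i\<^sub>F\<close>.\<close>

definition marginal_matrix ::
    "'v set \<Rightarrow> 'v set set \<Rightarrow> ('v \<Rightarrow> nat) \<Rightarrow> ('v set \<times> ('v \<Rightarrow> nat), 'v \<Rightarrow> nat) int_matrix" where
  "marginal_matrix V \<Gamma> d =
     \<lparr>rows = (SIGMA F:facets \<Gamma>. multi_indices d F),
      cols = multi_indices d V,
      entry = (\<lambda>(F, a) i. if restrict i F = a then 1 else 0)\<rparr>"

definition graph_complex :: "'v set \<Rightarrow> 'v set set \<Rightarrow> 'v set set" where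
  "graph_complex V E = {{}} \<union> {{v} |v. v \<in> V} \<union> E"

definition K2_verts :: "nat \<Rightarrow> nat set" where
  "K2_verts N = {1..N + 2}"

definition K2_edges :: "nat \<Rightarrow> nat set set" where
  "K2_edges N = {{i, j} |i j. i \<in> {1, 2} \<and> j \<in> {3..N + 2}}"

definition K2_complex :: "nat \<Rightarrow> nat set set" where
  "K2_complex N = graph_complex (K2_verts N) (K2_edges N)"

lemma facets_K2_complex:
  assumes "N \<ge> 1"
  shows "facets (K2_complex N) = K2_edges N"
proof -
  have edge: "{i, j} \<in> K2_edges N" if "i \<in> {1, 2}" "j \<in> {3..N + 2}" for i j
    using that unfolding K2_edges_def by blast
  have card_edge: "card F = 2" if "F \<in> K2_edges N" for F
    using that by (auto simp: K2_edges_def)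
  have small: "finite G \<and> card G \<le> 2" if G: "G \<in> K2_complex N" for G
  proof -
    consider "G = {}" | v where "G = {v}" | "G \<in> K2_edges N"
      using G unfolding K2_complex_def graph_complex_def by blast
    then show ?thesis
    proof cases
      case 3
      then have "card G = 2" by (rule card_edge)
      then show ?thesis by (simp add: card_ge_0_finite)
    qed simp_all
  qed
  have max: "F = G" if "F \<in> K2_edges N" "G \<in> K2_complex N" "F \<subseteq> G" for F G
    using card_seteq[of G F] card_edge[of F] small[of G] that by simp
  have cover: "\<exists>e \<in> K2_edges N. F \<subset> e" if F: "F \<in> K2_complex N" "F \<notin> K2_edges N" for F
  proof -
    consider "F = {}" | v where "F = {v}" "v \<in> K2_verts N"
      using F unfolding K2_complex_def graph_complex_def by blast
    then show ?thesis
    proof cases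
      case 1
      have "{1, 3} \<in> K2_edges N" using assms by (intro edge) simp_all
      with 1 show ?thesis by blast
    next
      case (2 v)
      show ?thesis
      proof (cases "v \<le> 2")
        case True
        with 2(2) have "v = 1 \<or> v = 2"
          by (simp add: K2_verts_def) linarith
        then have "{v, 3} \<in> K2_edges N"
          using assms by (intro edge) simp_all
        moreover have "F \<subset> {v, 3}" unfolding 2(1) using True by (intro psubsetI) auto
        ultimately show ?thesis by blast
      next
        case False
        with 2(2) have "v \<in> {3..N + 2}"
          by (simp add: K2_verts_def)
        then have "{1, v} \<in> K2_edges N"
          by (intro edge) simp_all
        moreover have "F \<subset> {1, v}" unfolding 2(1) using False by (intro psubsetI) auto
        ultimately show ?thesis by blast
      qed
    qed
  qed
  have sub: "K2_edges N \<subseteq> K2_complex N"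
    unfolding K2_complex_def graph_complex_def by blast
  show ?thesis
  proof (rule set_eqI)
    fix F
    show "F \<in> facets (K2_complex N) \<longleftrightarrow> F \<in> K2_edges N"
    proof
      assume F: "F \<in> facets (K2_complex N)"
      show "F \<in> K2_edges N"
      proof (rule ccontr)
        assume "F \<notin> K2_edges N"
        with F cover[of F] obtain e where "e \<in> K2_edges N" "F \<subset> e"
          by (auto simp: facets_def)
        with F sub show False
          by (auto simp: facets_def)
      qed
    next
      assume "F \<in> K2_edges N"
      then show "F \<in> facets (K2_complex N)"
        using max sub by (auto simp: facets_def)
    qed
  qed
qed

end

theory Submission
  imports Defs "HOL-Library.Multiset"
begin

text \<open>
  A nonnegative table over the index set \<open>D\<^sub>V\<close> is a multiset \<open>v\<close> of indices \<open>i\<close>, and its fiber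
  consists of all tables that have, for each \<open>j \<ge> 3\<close>, the same multiset of pairs \<open>(i\<^sub>1, i\<^sub>j)\<close>
  and the same multiset of pairs \<open>(i\<^sub>2, i\<^sub>j)\<close>. The graph \<open>K\<^bsub>2,N\<^esub>\<close> is obtained by gluing the
  paths \<open>1 - j - 2\<close> along the non-edge \<open>{1, 2}\<close>. Accordingly \<open>v\<close> is determined, up to moves
  that exchange the \<open>j\<close>-th coordinates of two indices with equal \<open>(i\<^sub>1, i\<^sub>2)\<close>, by its three-way
  marginals on \<open>{1, 2, j}\<close>, and a family of three-way tables comes from some \<open>v\<close> iff all
  members have the same marginal on \<open>{1, 2}\<close> (\<open>realization_exists\<close>, \<open>realizations_joined\<close>). The
  difficulty is that this common \<open>{1, 2}\<close>-marginal \<open>T\<close> varies over the fiber, and that all the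
  \<open>N\<close> three-way tables have to follow each change of \<open>T\<close> simultaneously.

  Since the first vertex has only two values, two three-way tables with the same marginals on
  \<open>{1, j}\<close> and \<open>{2, j}\<close> differ by elementary exchanges (\<open>tables_differ_by_exchanges\<close>): from
  the cells \<open>(1, b, x)\<close> and \<open>(2, b', x)\<close> to the cells \<open>(1, b', x)\<close> and \<open>(2, b, x)\<close>. Such an
  exchange is an edge \<open>b \<rightarrow> b'\<close> of a directed multigraph on the \<open>k\<close> values of the second
  vertex, and its effect on \<open>T\<close> is the net flow of that edge. So two elements of a fiber yield,
  for each \<open>j\<close>, a multigraph \<open>c\<^sub>j\<close> on \<open>k\<close> nodes, and all the \<open>c\<^sub>j\<close> have the same net flow
  \<open>z\<close>. It suffices to find subgraphs \<open>f\<^sub>j\<close> of bounded size, not all of them empty, which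
  again have a common net flow \<open>g\<close>: performing just these exchanges is a bounded change that
  brings the first table closer to the second (\<open>lift_table_change\<close> realises it by a bounded
  move), and induction on the number of exchanges finishes the proof.

  That \<open>g\<close> can be chosen depending on \<open>z\<close> only (\<open>bounded_subflow\<close>) rests on two facts. By a
  max-flow min-cut argument, a multigraph \<open>c\<close> has a subgraph of net flow \<open>g\<close> as soon as
  \<open>g(S)\<close> is at most the number of edges of \<open>c\<close> that enter \<open>S\<close>, for every node set \<open>S\<close>
  (\<open>subflow_exists\<close>); if \<open>c\<close> has net flow \<open>z\<close>, this number is at least \<open>max 0 (z(S))\<close>,
  whatever \<open>c\<close> is. And by Dickson's lemma, applied to the \<open>2\<^sup>k\<close> numbers \<open>max 0 (z(S))\<close>,
  there are finitely many nonzero \<open>g\<close> among which every nonzero \<open>z\<close> finds one with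
  \<open>g(S) \<le> max 0 (z(S))\<close> for all \<open>S\<close>. A second use of Dickson's lemma bounds the size of the
  subgraphs.
\<close>

section \<open>Dickson's lemma\<close>

text \<open>The map \<open>e\<close> gives the coordinates in which objects are compared, so that the
  lemma applies both to multisets (through their counts) and to integer vectors (through the
  positive parts of linear forms).\<close>

lemma dickson:
  fixes e :: "'z \<Rightarrow> 'a \<Rightarrow> nat"
  assumes "finite X"
  shows "\<exists>M. finite M \<and> M \<subseteq> P \<and> (\<forall>z\<in>P. \<exists>g\<in>M. \<forall>i\<in>X. e g i \<le> e z i)"
  using assms
proof (induction X arbitrary: P rule: finite_induct)
  case empty
  show ?case
  proof (cases "P = {}")
    case False
    then obtain p where "p \<in> P" by blast
    then show ?thesis by (intro exI[of _ "{p}"]) auto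
  qed auto
next
  case (insert x X)
  obtain M where M: "finite M" "M \<subseteq> P" "\<forall>z\<in>P. \<exists>g\<in>M. \<forall>i\<in>X. e g i \<le> e z i"
    using insert.IH[of P] by blast
  \<comment> \<open>The basis \<open>M\<close> for the old coordinates serves all objects whose new coordinate
    exceeds \<open>n\<close>; each of the remaining values of that coordinate has a finite basis of its own.\<close>
  define n where "n = Max (insert 0 ((\<lambda>g. e g x) ` M))"
  have n: "e g x \<le> n" if "g \<in> M" for g
    unfolding n_def using M(1) that by (intro Max_ge) auto
  have "\<forall>m. \<exists>L. finite L \<and> L \<subseteq> {z \<in> P. e z x = m} \<and>
      (\<forall>z\<in>{z \<in> P. e z x = m}. \<exists>g\<in>L. \<forall>i\<in>X. e g i \<le> e z i)"
    using insert.IH by blast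
  from choice[OF this] obtain L where L: "\<forall>m. finite (L m) \<and> L m \<subseteq> {z \<in> P. e z x = m} \<and>
      (\<forall>z\<in>{z \<in> P. e z x = m}. \<exists>g\<in>L m. \<forall>i\<in>X. e g i \<le> e z i)" ..
  show ?case
  proof (intro exI[of _ "M \<union> (\<Union>m\<le>n. L m)"] conjI ballI)
    show "finite (M \<union> (\<Union>m\<le>n. L m))" using M(1) L by simp
    show "M \<union> (\<Union>m\<le>n. L m) \<subseteq> P" using M(2) L by blast
    fix z assume z: "z \<in> P"
    show "\<exists>g\<in>M \<union> (\<Union>m\<le>n. L m). \<forall>i\<in>insert x X. e g i \<le> e z i"
    proof (cases "e z x \<le> n")
      case True
      obtain g where g: "g \<in> L (e z x)" "\<forall>i\<in>X. e g i \<le> e z i" using L z by blast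
      moreover have "e g x = e z x" using g(1) L by blast
      ultimately show ?thesis using True by (intro bexI[of _ g]) auto
    next
      case False
      obtain g where g: "g \<in> M" "\<forall>i\<in>X. e g i \<le> e z i" using M(3) z by blast
      then show ?thesis using n[of g] False by (intro bexI[of _ g]) auto
    qed
  qed
qed

section \<open>Subflows of directed multigraphs\<close>

text \<open>A directed multigraph is the multiset of its edges.\<close>

definition net :: "('b \<times> 'b) multiset \<Rightarrow> 'b \<Rightarrow> int" where
  "net c b = int (count (image_mset snd c) b) - int (count (image_mset fst c) b)"

definition inflow :: "('b \<times> 'b) multiset \<Rightarrow> 'b set \<Rightarrow> int" where
  "inflow c S = int (size (filter_mset (\<lambda>e. snd e \<in> S \<and> fst e \<notin> S) c))"

lemma net_empty [simp]: "net {#} b = 0"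
  by (simp add: net_def)

lemma net_add [simp]: "net (add_mset e c) b = net c b + of_bool (b = snd e) - of_bool (b = fst e)"
  by (auto simp: net_def)

lemma inflow_add [simp]:
  "inflow (add_mset e c) S = inflow c S + of_bool (snd e \<in> S \<and> fst e \<notin> S)"
  by (simp add: inflow_def)

lemma inflow_empty [simp]: "inflow {#} S = 0"
  by (simp add: inflow_def)

lemma net_outside:
  assumes "set_mset c \<subseteq> K \<times> K" "b \<notin> K"
  shows "net c b = 0"
proof -
  have "b \<notin># image_mset snd c" "b \<notin># image_mset fst c"
    using assms by fastforce+
  then show ?thesis unfolding net_def not_in_iff by simp
qed

lemma sum_net_all:
  assumes "finite K" "set_mset c \<subseteq> K \<times> K"
  shows "sum (net c) K = 0"
  using assms(2)
proof (induction c)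
  case (add e c)
  then show ?case
    using assms(1) by (auto simp: sum.distrib sum_subtractf of_bool_def)
qed auto

lemma inflow_submodular:
  "inflow c (X \<union> S) + inflow c (X \<inter> S) \<le> inflow c X + inflow c S"
  by (induction c) auto

lemma sum_net_le_inflow:
  assumes "finite S"
  shows "sum (net c) S \<le> inflow c S"
proof (induction c)
  case (add e c)
  have "sum (net (add_mset e c)) S = sum (net c) S + of_bool (snd e \<in> S) - of_bool (fst e \<in> S)"
    using assms by (simp add: sum.distrib sum_subtractf of_bool_def sum.delta)
  then show ?case using add.IH by auto
qed auto

text \<open>The edges of \<open>c\<close> are considered one at a time. If the cut condition survives the deletion of an edge, the edge is dropped. Otherwise the edge
  enters a set \<open>S\<close> whose condition is tight; then the edge is used, and submodularity of \<open>inflow\<close>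
  against \<open>S\<close> gives the condition for the remaining demand \<open>g'\<close>.\<close>

lemma subflow_exists:
  fixes g :: "'b \<Rightarrow> int"
  assumes "finite K" "set_mset c \<subseteq> K \<times> K" "\<And>b. b \<notin> K \<Longrightarrow> g b = 0" "sum g K = 0"
    and "\<And>S. S \<subseteq> K \<Longrightarrow> sum g S \<le> inflow c S"
  shows "\<exists>f. f \<subseteq># c \<and> net f = g"
  using assms(2-)
proof (induction c arbitrary: g)
  case empty
  have "g b \<le> 0" if "b \<in> K" for b using empty.prems(4)[of "{b}"] that by simp
  then have "\<forall>b\<in>K. - g b = 0" using assms(1) empty.prems(3)
    by (subst sum_nonneg_eq_0_iff[symmetric]) (auto simp: sum_negf)
  then have "net {#} = g" using empty.prems(2) by (intro ext, simp) (metis)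
  then show ?case by blast
next
  case (add e c)
  have e: "fst e \<in> K" "snd e \<in> K" "set_mset c \<subseteq> K \<times> K" using add.prems(1) by auto
  show ?case
  proof (cases "\<forall>S\<subseteq>K. sum g S \<le> inflow c S")
    case True
    then obtain f where "f \<subseteq># c" "net f = g" using add.IH[of g] add.prems e(3) by blast
    then have "f \<subseteq># add_mset e c"
      by (meson multi_psub_of_add_self subset_mset.less_imp_le subset_mset.order_trans)
    then show ?thesis using \<open>net f = g\<close> by blast
  next
    case False
    then obtain S where S: "S \<subseteq> K" "sum g S > inflow c S" by force
    have enter: "snd e \<in> S" "fst e \<notin> S" and tight: "sum g S = inflow c S + 1"
      using add.prems(4)[OF S(1)] S(2) by (auto split: if_splits simp: of_bool_def)
    define g' where "g' b = g b - of_bool (b = snd e) + of_bool (b = fst e)" for b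
    have sum_g': "sum g' X = sum g X - of_bool (snd e \<in> X) + of_bool (fst e \<in> X)" if "X \<subseteq> K" for X
      using finite_subset[OF that assms(1)]
      by (simp add: g'_def sum.distrib sum_subtractf of_bool_def sum.delta)
    have "\<exists>f. f \<subseteq># c \<and> net f = g'"
    proof (rule add.IH)
      show "set_mset c \<subseteq> K \<times> K" by (rule e)
      show "g' b = 0" if "b \<notin> K" for b using that e add.prems(2) by (auto simp: g'_def)
      show "sum g' K = 0" using sum_g'[of K] add.prems(3) e by simp
      fix X assume X: "X \<subseteq> K"
      show "sum g' X \<le> inflow c X"
      \<comment> \<open>Only a set that the edge leaves has a greater demand than before.\<close>
      proof (cases "fst e \<in> X \<and> snd e \<notin> X")
        case False
        then show ?thesis using sum_g'[OF X] add.prems(4)[OF X] by auto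
      next
        case True
        have fin: "finite X" "finite S" using X S(1) assms(1) finite_subset by auto
        have "sum g X + sum g S = sum g (X \<union> S) + sum g (X \<inter> S)"
          using fin by (simp add: sum.union_inter)
        also have "\<dots> \<le> inflow c (X \<union> S) + inflow c (X \<inter> S)"
          using add.prems(4)[of "X \<union> S"] add.prems(4)[of "X \<inter> S"] X S(1) True
          by (simp add: le_infI1)
        also have "\<dots> \<le> inflow c X + inflow c S" by (rule inflow_submodular)
        finally show ?thesis using tight True sum_g'[OF X] by simp
      qed
    qed
    then obtain f where "f \<subseteq># c" "net f = g'" by blast
    then have "add_mset e f \<subseteq># add_mset e c \<and> net (add_mset e f) = g"
      by (auto simp: g'_def fun_eq_iff)
    then show ?thesis by blast
  qed
qed

text \<open>The point is the order of the quantifiers: the net flow \<open>g\<close> depends on \<open>z\<close> alone, so that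
  it serves any number of multigraphs with net flow \<open>z\<close> at once. For \<open>z = 0\<close> the subflows are
  circulations.\<close>

lemma bounded_subflow:
  fixes K :: "'b set"
  assumes K: "finite K"
  shows "\<exists>C. \<forall>z. \<exists>g. \<forall>c. set_mset c \<subseteq> K \<times> K \<and> net c = z \<longrightarrow>
    (\<exists>f. f \<subseteq># c \<and> net f = g \<and> size f \<le> C \<and> (c \<noteq> {#} \<longrightarrow> f \<noteq> {#}))"
proof -
  define Z where "Z = {z :: 'b \<Rightarrow> int. (\<forall>b. b \<notin> K \<longrightarrow> z b = 0) \<and> sum z K = 0 \<and> z \<noteq> (\<lambda>_. 0)}"
  \<comment> \<open>Comparison in these coordinates gives \<open>g(S) \<le> max 0 (z(S))\<close> for all \<open>S\<close>.\<close>
  define e where "e z S = nat (sum z S)" for z :: "'b \<Rightarrow> int" and S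
  obtain M where M: "finite M" "M \<subseteq> Z" "\<forall>z\<in>Z. \<exists>g\<in>M. \<forall>S\<in>Pow K. e g S \<le> e z S"
    using dickson[of "Pow K" Z e] K by auto
  define P where "P g = {f. f \<noteq> {#} \<and> set_mset f \<subseteq> K \<times> K \<and> net f = g}" for g
  have "\<forall>g. \<exists>L. finite L \<and> L \<subseteq> P g \<and> (\<forall>c\<in>P g. \<exists>f\<in>L. \<forall>i\<in>K \<times> K. count f i \<le> count c i)"
    using K by (intro allI dickson) simp
  from choice[OF this] obtain L where L: "\<forall>g. finite (L g) \<and> L g \<subseteq> P g \<and>
      (\<forall>c\<in>P g. \<exists>f\<in>L g. \<forall>i\<in>K \<times> K. count f i \<le> count c i)" ..
  define C where "C = Max (insert 0 (size ` (\<Union>g\<in>insert (\<lambda>_. 0) M. L g)))"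
  have small: "\<exists>f\<in>P g. f \<subseteq># c \<and> size f \<le> C" if c: "c \<in> P g" and g: "g \<in> insert (\<lambda>_. 0) M" for c g
  proof -
    obtain f where f: "f \<in> L g" "\<forall>i\<in>K \<times> K. count f i \<le> count c i" using L c by blast
    have fP: "f \<in> P g" using f(1) L by blast
    have "count f i \<le> count c i" for i
    proof (cases "i \<in> K \<times> K")
      case False
      then have "i \<notin># f" using fP unfolding P_def by blast
      then show ?thesis by (simp add: not_in_iff)
    qed (use f(2) in blast)
    moreover have "size f \<le> C" unfolding C_def
      using M(1) L f(1) g by (intro Max_ge) auto
    ultimately show ?thesis using fP by (auto simp: subseteq_mset_def)
  qed
  have "\<exists>g. \<forall>c. set_mset c \<subseteq> K \<times> K \<and> net c = z \<longrightarrow>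
    (\<exists>f. f \<subseteq># c \<and> net f = g \<and> size f \<le> C \<and> (c \<noteq> {#} \<longrightarrow> f \<noteq> {#}))" for z
  proof -
    consider "z = (\<lambda>_. 0)" | "z \<in> Z" | "z \<noteq> (\<lambda>_. 0)" "z \<notin> Z" by blast
    then show ?thesis
    proof cases
      case 1
      have "\<exists>f. f \<subseteq># c \<and> net f = (\<lambda>_. 0) \<and> size f \<le> C \<and> (c \<noteq> {#} \<longrightarrow> f \<noteq> {#})"
        if c: "set_mset c \<subseteq> K \<times> K" "net c = (\<lambda>_. 0)" for c
      proof (cases "c = {#}")
        case True
        then show ?thesis by (intro exI[of _ "{#}"]) (auto simp: fun_eq_iff)
      next
        case False
        then have "c \<in> P (\<lambda>_. 0)" using c by (simp add: P_def)
        then obtain f where "f \<in> P (\<lambda>_. 0)" "f \<subseteq># c" "size f \<le> C" using small by blast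
        then show ?thesis unfolding P_def by blast
      qed
      then show ?thesis unfolding 1 by blast
    next
      case 2
      then obtain g where g: "g \<in> M" "\<forall>S\<in>Pow K. e g S \<le> e z S" using M(3) by blast
      have gZ: "g \<in> Z" using g(1) M(2) by blast
      have "\<exists>f. f \<subseteq># c \<and> net f = g \<and> size f \<le> C \<and> (c \<noteq> {#} \<longrightarrow> f \<noteq> {#})"
        if c: "set_mset c \<subseteq> K \<times> K" "net c = z" for c
      proof -
        have "\<exists>f. f \<subseteq># c \<and> net f = g"
        proof (rule subflow_exists[OF K])
          fix S assume S: "S \<subseteq> K"
          have "nat (sum g S) \<le> nat (sum z S)" using g(2) S by (auto simp: e_def)
          moreover have "sum z S \<le> inflow c S"
            using sum_net_le_inflow[OF finite_subset[OF S K], of c] c(2) by simp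
          moreover have "0 \<le> inflow c S" by (simp add: inflow_def)
          ultimately show "sum g S \<le> inflow c S" by linarith
        qed (use c gZ in \<open>auto simp: Z_def\<close>)
        then obtain f where f: "f \<subseteq># c" "net f = g" by blast
        have "f \<noteq> {#}" using f(2) gZ by (auto simp: Z_def fun_eq_iff)
        moreover have "set_mset f \<subseteq> K \<times> K" using f(1) c(1) set_mset_mono by blast
        ultimately have "f \<in> P g" using f(2) by (auto simp: P_def)
        then obtain f' where "f' \<in> P g" "f' \<subseteq># f" "size f' \<le> C" using small g(1) by blast
        then show ?thesis using f(1) unfolding P_def by (auto intro: subset_mset.order_trans)
      qed
      then show ?thesis by blast
    next
      case 3
      have "z \<in> Z" if "set_mset c \<subseteq> K \<times> K" "net c = z" for c
        using 3(1) net_outside[OF that(1)] sum_net_all[OF K that(1)] that(2) by (simp add: Z_def)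
      then show ?thesis using 3(2) by blast
    qed
  qed
  then show ?thesis by blast
qed

section \<open>Moves between multisets\<close>

definition move :: "nat \<Rightarrow> 'i multiset \<Rightarrow> 'i multiset \<Rightarrow> bool" where
  "move C v v' \<longleftrightarrow> (\<exists>r w w'. v = r + w \<and> v' = r + w' \<and> size w \<le> C \<and> size w' \<le> C)"

definition joined :: "'i multiset set \<Rightarrow> nat \<Rightarrow> 'i multiset \<Rightarrow> 'i multiset \<Rightarrow> bool" where
  "joined F C = (\<lambda>v v'. v \<in> F \<and> v' \<in> F \<and> move C v v')\<^sup>*\<^sup>*"

lemma joined_mono:
  assumes "joined F C v v'" "F \<subseteq> F'" "C \<le> C'"
  shows "joined F' C' v v'"
proof -
  have "move C' u u'" if uu: "move C u u'" for u u'
  proof -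
    obtain r d d' where "u = r + d" "u' = r + d'" "size d \<le> C" "size d' \<le> C"
      using uu unfolding move_def by blast
    then show ?thesis using assms(3) unfolding move_def
      by (intro exI[of _ r] exI[of _ d] exI[of _ d']) simp
  qed
  then have "(\<lambda>v v'. v \<in> F \<and> v' \<in> F \<and> move C v v') \<le> (\<lambda>v v'. v \<in> F' \<and> v' \<in> F' \<and> move C' v v')"
    using assms(2) by blast
  then show ?thesis using assms(1) rtranclp_mono unfolding joined_def by blast
qed

lemma joined_refl: "joined F C v v" by (simp add: joined_def)
lemma joined_trans: "joined F C v v' \<Longrightarrow> joined F C v' v'' \<Longrightarrow> joined F C v v''"
  by (simp add: joined_def)
lemma joined_step: "v \<in> F \<Longrightarrow> v' \<in> F \<Longrightarrow> move C v v' \<Longrightarrow> joined F C v v'"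
  by (auto simp: joined_def)

lemma joined_add:
  assumes "joined F C v v'" and "\<And>u. u \<in> F \<Longrightarrow> u + w \<in> F'"
  shows "joined F' C (v + w) (v' + w)"
  using assms(1) unfolding joined_def
proof (induction rule: rtranclp_induct)
  case (step y z)
  obtain r d d' where "y = r + d" "z = r + d'" "size d \<le> C" "size d' \<le> C"
    using step(2) unfolding move_def by blast
  then have "move C (y + w) (z + w)" unfolding move_def
    by (intro exI[of _ "r + w"] exI[of _ d] exI[of _ d']) simp
  moreover have "y + w \<in> F'" "z + w \<in> F'" using step(2) assms(2) by blast+
  ultimately show ?case by (intro rtranclp.rtrancl_into_rtrancl[OF step.IH]) blast
qed simp

section \<open>Tables with prescribed three-way marginals\<close>

definition cell :: "nat \<Rightarrow> (nat \<Rightarrow> nat) \<Rightarrow> (nat \<times> nat) \<times> nat" where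
  "cell j i = ((i 1, i 2), i j)"

text \<open>The set \<open>J\<close> stands for the second part of the bipartite graph; requiring extensional
  indices makes an index determined by its coordinates in \<open>{1, 2} \<union> J\<close>.\<close>

definition realizations ::
    "nat set \<Rightarrow> (nat \<Rightarrow> ((nat \<times> nat) \<times> nat) multiset) \<Rightarrow> (nat \<Rightarrow> nat) multiset set" where
  "realizations J t = {v. set_mset v \<subseteq> extensional ({1, 2} \<union> J) \<and>
     (\<forall>j\<in>J. image_mset (cell j) v = t j)}"

lemma realizations_add:
  "v \<in> realizations J t \<Longrightarrow> w \<in> realizations J s \<Longrightarrow> v + w \<in> realizations J (\<lambda>j. t j + s j)"
  by (auto simp: realizations_def)

text \<open>Line up, for each \<open>j\<close>, the entries of \<open>t j\<close> along the common list of \<open>{1, 2}\<close>-parts.\<close>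

lemma realization_exists:
  assumes J: "1 \<notin> J" "2 \<notin> J" and "\<And>j. j \<in> J \<Longrightarrow> image_mset fst (t j) = T"
  shows "\<exists>v. v \<in> realizations J t \<and> size v = size T"
  using assms(3)
proof (induction T arbitrary: t)
  case empty
  then have "{#} \<in> realizations J t" by (auto simp: realizations_def)
  then show ?case by force
next
  case (add p T)
  have "\<exists>x s. t j = add_mset (p, x) s \<and> image_mset fst s = T" if j: "j \<in> J" for j
  proof -
    obtain q s where "t j = add_mset q s" "fst q = p" "image_mset fst s = T"
      using msed_map_invR[OF add.prems[OF j]] by blast
    then show ?thesis by (cases q) auto
  qed
  then obtain x s where xs: "\<And>j. j \<in> J \<Longrightarrow> t j = add_mset (p, x j) (s j)"
    "\<And>j. j \<in> J \<Longrightarrow> image_mset fst (s j) = T" by metis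
  obtain v where v: "v \<in> realizations J s" "size v = size T" using add.IH[of s] xs(2) by blast
  define i where "i = (\<lambda>t. if t = 1 then fst p else if t = 2 then snd p
    else if t \<in> J then x t else undefined)"
  have "cell j i = (p, x j)" if "j \<in> J" for j using that J by (auto simp: cell_def i_def)
  moreover have "i \<in> extensional ({1, 2} \<union> J)" by (auto simp: i_def extensional_def)
  ultimately have "add_mset i v \<in> realizations J t" using v(1) xs(1) by (auto simp: realizations_def)
  then show ?case using v(2) by force
qed

text \<open>An index that the marginals allow can be assembled inside \<open>v\<close>: start with an index of \<open>v\<close>
  that has the right \<open>{1, 2}\<close>-part and correct its coordinates \<open>j\<close> one at a time, by exchanging
  the \<open>j\<close>-th coordinate with an index of the same \<open>{1, 2}\<close>-part that has the desired one. Such an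
  exchange preserves all three-way marginals.\<close>

lemma joined_with_index:
  assumes J: "finite J" "1 \<notin> J" "2 \<notin> J" "J \<noteq> {}"
    and i: "i \<in> extensional ({1, 2} \<union> J)" "\<And>j. j \<in> J \<Longrightarrow> cell j i \<in># t j"
    and v: "v \<in> realizations J t"
  shows "\<exists>v'. v' \<in> realizations J t \<and> joined (realizations J t) 2 v v' \<and> i \<in># v'"
proof -
  have "L \<subseteq> J \<Longrightarrow> \<exists>v' s. v' \<in> realizations J t \<and> joined (realizations J t) 2 v v' \<and> s \<in># v' \<and>
      s 1 = i 1 \<and> s 2 = i 2 \<and> (\<forall>j\<in>L. s j = i j)" if "finite L" for L
    using that
  proof (induction L rule: finite_induct)
    case empty
    obtain j where j: "j \<in> J" using J by blast
    have "cell j i \<in># image_mset (cell j) v" using i(2)[OF j] v j by (auto simp: realizations_def)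
    then obtain s where "s \<in># v" "cell j s = cell j i" by auto
    then show ?case using v by (intro exI[of _ v] exI[of _ s]) (auto simp: cell_def joined_refl)
  next
    case (insert j L)
    then obtain v' s where v': "v' \<in> realizations J t" "joined (realizations J t) 2 v v'"
      and s: "s \<in># v'" "s 1 = i 1" "s 2 = i 2" "\<forall>j\<in>L. s j = i j" by auto
    have j: "j \<in> J" "j \<noteq> 1" "j \<noteq> 2" using insert.prems J by auto
    show ?case
    proof (cases "s j = i j")
      case True
      then show ?thesis using v' s by (intro exI[of _ v'] exI[of _ s]) auto
    next
      case False
      have "cell j i \<in># image_mset (cell j) v'" using i(2) v'(1) j by (auto simp: realizations_def)
      then obtain q where q: "q \<in># v'" "q 1 = i 1" "q 2 = i 2" "q j = i j" by (auto simp: cell_def)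
      have "q \<noteq> s" using q(4) False by auto
      with s(1) q(1) obtain r where r: "v' = add_mset q (add_mset s r)"
        by (metis insert_DiffM insert_noteq_member)
      define w where "w = r + {#q(j := s j), s(j := q j)#}"
      have "w \<in> realizations J t"
      proof -
        have "image_mset (cell l) w = image_mset (cell l) v'" for l
          using j q(2,3) s(2,3) by (cases "l = j") (auto simp: w_def r cell_def)
        moreover have "set_mset w \<subseteq> extensional ({1, 2} \<union> J)"
          using v'(1) j(1) unfolding w_def r realizations_def by (auto simp: extensional_def)
        ultimately show ?thesis using v'(1) by (simp add: realizations_def)
      qed
      moreover have "move 2 v' w"
        unfolding move_def by (rule exI[of _ r], rule exI[of _ "{#q, s#}"]) (auto simp: r w_def)
      ultimately have "joined (realizations J t) 2 v w"
        using v' joined_trans joined_step by metis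
      moreover have "s(j := q j) \<in># w" by (simp add: w_def)
      moreover have "\<forall>l\<in>insert j L. (s(j := q j)) l = i l" "(s(j := q j)) 1 = i 1"
        "(s(j := q j)) 2 = i 2" using s q j by auto
      ultimately show ?thesis using \<open>w \<in> _\<close> by blast
    qed
  qed
  from this[OF J(1) order_refl] obtain v' s where
    v': "v' \<in> realizations J t" "joined (realizations J t) 2 v v'" and
    s: "s \<in># v'" "s 1 = i 1" "s 2 = i 2" "\<forall>j\<in>J. s j = i j" by auto
  have "s \<in> extensional ({1, 2} \<union> J)" using v'(1) s(1) by (auto simp: realizations_def)
  then have "s = i" using i(1) s by (intro extensionalityI) auto
  then show ?thesis using v' s by blast
qed

lemma realizations_joined:
  assumes J: "finite J" "1 \<notin> J" "2 \<notin> J" "J \<noteq> {}"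
    and "v \<in> realizations J t" "v' \<in> realizations J t"
  shows "joined (realizations J t) 2 v v'"
  using assms(5,6)
proof (induction v' arbitrary: v t)
  case empty
  obtain j where j: "j \<in> J" using J by blast
  have "image_mset (cell j) v = {#}" using empty j unfolding realizations_def by force
  then show ?case by (simp add: joined_refl)
next
  case (add i v')
  have i: "i \<in> extensional ({1, 2} \<union> J)" "\<And>j. j \<in> J \<Longrightarrow> cell j i \<in># t j"
    using add.prems(2) unfolding realizations_def by (auto, metis union_single_eq_member)
  obtain u where u: "u \<in> realizations J t" "joined (realizations J t) 2 v u" "i \<in># u"
    using joined_with_index[OF J i add.prems(1)] by blast
  obtain u' where u': "u = add_mset i u'" using u(3) by (metis multi_member_split)
  define t' where "t' j = t j - {#cell j i#}" for j
  have t': "t j = t' j + {#cell j i#}" if "j \<in> J" for j using i(2)[OF that] by (simp add: t'_def)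
  have "u' \<in> realizations J t'" using u(1) t' unfolding u' realizations_def by auto
  moreover have "v' \<in> realizations J t'" using add.prems(2) t' unfolding realizations_def by auto
  ultimately have "joined (realizations J t') 2 u' v'" using add.IH by blast
  then have "joined (realizations J t) 2 (u' + {#i#}) (v' + {#i#})"
    by (rule joined_add) (use i t' in \<open>auto simp: realizations_def\<close>)
  then show ?case using u(2) joined_trans unfolding u' by simp
qed

lemma sub_multiset_with_image:
  assumes "image_mset f D \<subseteq># M" "M \<subseteq># image_mset f (D + R)"
  shows "\<exists>E. E \<subseteq># R \<and> image_mset f (D + E) = M"
proof -
  have "M - image_mset f D \<subseteq># image_mset f R"
    using assms(2) by (simp add: subset_eq_diff_conv union_commute)
  then obtain Q where "image_mset f R = (M - image_mset f D) + Q"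
    by (auto simp: mset_subset_eq_exists_conv)
  then obtain E E' where "R = E + E'" "image_mset f E = M - image_mset f D"
    using image_mset_eq_plusD by metis
  then show ?thesis using assms(1) by (intro exI[of _ E]) auto
qed

text \<open>The replacement of \<open>D j\<close> by \<open>D' j\<close> in all three-way marginals simultaneously has to be
  carried out on few indices, although the number of the \<open>j\<close> is unbounded. For that purpose
  enlarge every \<open>D j\<close> by some unchanged entries \<open>E j\<close> until its \<open>{1, 2}\<close>-marginal is a
  multiset \<open>M\<close> that is the same for all \<open>j\<close>. Then the enlarged entries are realised by a table
  \<open>w\<close> of size at most \<open>C * card K\<close>, and only \<open>w\<close> is replaced. The table \<open>u\<close> that contains
  \<open>w\<close> is in general not \<open>v\<close>, but has the same three-way marginals.\<close>

lemma lift_table_change: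
  assumes J: "finite J" "1 \<notin> J" "2 \<notin> J" "J \<noteq> {}"
    and v: "v \<in> realizations J (\<lambda>j. R j + D j)"
    and T: "\<And>j. j \<in> J \<Longrightarrow> image_mset fst (R j + D' j) = T"
    and size: "\<And>j. j \<in> J \<Longrightarrow> size (D j) \<le> C \<and> size (D' j) = size (D j)"
    and keys: "(\<lambda>i. (i 1, i 2)) ` set_mset v \<subseteq> K" "finite K"
  shows "\<exists>u v'. u \<in> realizations J (\<lambda>j. R j + D j) \<and> v' \<in> realizations J (\<lambda>j. R j + D' j) \<and>
    move (C * card K) u v'"
proof -
  define T0 where "T0 = image_mset (\<lambda>i. (i 1, i 2)) v"
  have T0: "image_mset fst (R j + D j) = T0" if "j \<in> J" for j
  proof -
    have "R j + D j = image_mset (cell j) v" using v that by (simp add: realizations_def)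
    then show ?thesis by (simp add: T0_def cell_def multiset.map_comp comp_def)
  qed
  \<comment> \<open>A pair occurs in the \<open>{1, 2}\<close>-marginal of \<open>D j\<close> at most as often as in that of \<open>v\<close>,
    and at most \<open>C\<close> times, so the minimum \<open>M\<close> of these two bounds works for all \<open>j\<close>.\<close>
  define M where "M = T0 \<inter># (\<Sum>p\<in>K. replicate_mset C p)"
  have "count (\<Sum>p\<in>K. replicate_mset C p) q = (if q \<in> K then C else 0)" for q
    using keys(2) by (simp add: count_sum sum.delta')
  then have count_M: "count M q = min (count T0 q) (if q \<in> K then C else 0)" for q
    by (simp add: M_def)
  have T0K: "set_mset T0 \<subseteq> K" using keys(1) by (auto simp: T0_def)
  have "size M \<le> size (\<Sum>p\<in>K. replicate_mset C p)" by (rule size_mset_mono) (simp add: M_def)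
  also have "\<dots> = C * card K" using keys(2) by (induction rule: finite_induct) auto
  finally have size_M: "size M \<le> C * card K" .
  have "\<exists>E. E \<subseteq># R j \<and> image_mset fst (D j + E) = M" if j: "j \<in> J" for j
  proof (rule sub_multiset_with_image)
    show "M \<subseteq># image_mset fst (D j + R j)"
      using T0[OF j] by (simp add: M_def union_commute)
    show "image_mset fst (D j) \<subseteq># M"
    proof (rule mset_subset_eqI)
      fix q
      have "count (image_mset fst (D j)) q \<le> size (D j)"
        by (metis count_le_size size_image_mset)
      moreover have "count (image_mset fst (D j)) q \<le> count T0 q"
        unfolding T0[OF j, symmetric] by simp
      moreover have "count T0 q = 0" if "q \<notin> K" using T0K that by (auto simp: count_eq_zero_iff)
      ultimately show "count (image_mset fst (D j)) q \<le> count M q"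
        using size[OF j] by (auto simp: count_M)
    qed
  qed
  then obtain E where E: "\<And>j. j \<in> J \<Longrightarrow> E j \<subseteq># R j"
    "\<And>j. j \<in> J \<Longrightarrow> image_mset fst (D j + E j) = M" by metis
  define Q where "Q j = R j - E j" for j
  have R: "R j = Q j + E j" if "j \<in> J" for j using E(1)[OF that] by (simp add: Q_def)
  have rest: "image_mset fst (Q j) = T0 - M" if "j \<in> J" for j
  proof -
    have "T0 = image_mset fst (Q j) + M"
      by (simp add: T0[OF that, symmetric] E(2)[OF that, symmetric] R[OF that])
    then show ?thesis by simp
  qed
  have new: "image_mset fst (D' j + E j) = T - (T0 - M)" if "j \<in> J" for j
  proof -
    have "T = (T0 - M) + image_mset fst (D' j + E j)"
      by (simp add: T[OF that, symmetric] rest[OF that, symmetric] R[OF that])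
    then show ?thesis by simp
  qed
  obtain r where r: "r \<in> realizations J (\<lambda>j. Q j)"
    using realization_exists[OF J(2,3), of Q, OF rest] by blast
  obtain w where w: "w \<in> realizations J (\<lambda>j. D j + E j)" "size w = size M"
    using realization_exists[OF J(2,3), of "\<lambda>j. D j + E j", OF E(2)] by blast
  obtain w' where w': "w' \<in> realizations J (\<lambda>j. D' j + E j)" "size w' = size (T - (T0 - M))"
    using realization_exists[OF J(2,3), of "\<lambda>j. D' j + E j", OF new] by blast
  obtain j where j: "j \<in> J" using J by blast
  have "size w' = size w"
    using w(2) w'(2) arg_cong[OF new[OF j], of size] arg_cong[OF E(2)[OF j], of size] size[OF j]
    by simp
  then have "move (C * card K) (r + w) (r + w')"
    unfolding move_def by (intro exI[of _ r] exI[of _ w] exI[of _ w']) (use w(2) size_M in simp)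
  moreover have "r + w \<in> realizations J (\<lambda>j. R j + D j)"
  proof -
    have "R j + D j = Q j + (D j + E j)" if "j \<in> J" for j
      using R[OF that] by simp
    then show ?thesis using realizations_add[OF r w(1)] by (simp add: realizations_def)
  qed
  moreover have "r + w' \<in> realizations J (\<lambda>j. R j + D' j)"
  proof -
    have "R j + D' j = Q j + (D' j + E j)" if "j \<in> J" for j
      using R[OF that] by simp
    then show ?thesis using realizations_add[OF r w'(1)] by (simp add: realizations_def)
  qed
  ultimately show ?thesis by blast
qed

section \<open>Exchanges in three-way tables\<close>

text \<open>An exchange is encoded as \<open>((b, b'), x)\<close>: an edge \<open>b \<rightarrow> b'\<close>, with the value \<open>x\<close> of the
  third coordinate at which it takes place.\<close>

definition removed :: "((nat \<times> nat) \<times> nat) multiset \<Rightarrow> ((nat \<times> nat) \<times> nat) multiset" where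
  "removed E = image_mset (\<lambda>((b, b'), x). ((1, b), x)) E +
    image_mset (\<lambda>((b, b'), x). ((2, b'), x)) E"

definition inserted :: "((nat \<times> nat) \<times> nat) multiset \<Rightarrow> ((nat \<times> nat) \<times> nat) multiset" where
  "inserted E = image_mset (\<lambda>((b, b'), x). ((1, b'), x)) E +
    image_mset (\<lambda>((b, b'), x). ((2, b), x)) E"

lemma removed_add: "removed (E + F) = removed E + removed F" by (simp add: removed_def)
lemma inserted_add: "inserted (E + F) = inserted E + inserted F" by (simp add: inserted_def)
lemma size_removed: "size (removed E) = 2 * size E" by (simp add: removed_def)
lemma size_inserted: "size (inserted E) = 2 * size E" by (simp add: inserted_def)

abbreviation marg1 :: "((nat \<times> nat) \<times> nat) multiset \<Rightarrow> (nat \<times> nat) multiset" where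
  "marg1 \<equiv> image_mset (\<lambda>((a, b), x). (a, x))"
abbreviation marg2 :: "((nat \<times> nat) \<times> nat) multiset \<Rightarrow> (nat \<times> nat) multiset" where
  "marg2 \<equiv> image_mset (\<lambda>((a, b), x). (b, x))"

lemma marg1_inserted_eq: "marg1 (inserted E) = marg1 (removed E)"
  by (induction E) (auto simp: removed_def inserted_def)

lemma marg2_inserted_eq: "marg2 (inserted E) = marg2 (removed E)"
  by (induction E) (auto simp: removed_def inserted_def)

lemma keys_removed: "image_mset fst (removed E) =
    image_mset (Pair 1) (image_mset fst (image_mset fst E)) +
    image_mset (Pair 2) (image_mset snd (image_mset fst E))"
  by (induction E) (auto simp: removed_def)

lemma keys_inserted: "image_mset fst (inserted E) =
    image_mset (Pair 1) (image_mset snd (image_mset fst E)) +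
    image_mset (Pair 2) (image_mset fst (image_mset fst E))"
  by (induction E) (auto simp: inserted_def)

lemma count_Pair: "count (image_mset (Pair a) B) (a', b) = (if a = a' then count B b else 0)"
  by (induction B) auto

text \<open>Hence the effect of exchanges on the \<open>{1, 2}\<close>-marginal depends on their net flow only.\<close>

lemma count_keys_change:
  "int (count (image_mset fst (inserted E)) (a, b)) - int (count (image_mset fst (removed E)) (a, b))
    = (if a = 1 then net (image_mset fst E) b else if a = 2 then - net (image_mset fst E) b else 0)"
  unfolding keys_removed keys_inserted by (simp add: count_Pair net_def)

lemma matching_exists:
  assumes "image_mset snd P = image_mset snd Q"
  shows "\<exists>E. image_mset (\<lambda>((b, b'), x). (b, x)) E = P \<and> image_mset (\<lambda>((b, b'), x). (b', x)) E = Q"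
  using assms
proof (induction P arbitrary: Q)
  case empty
  then show ?case by (intro exI[of _ "{#}"]) auto
next
  case (add p P)
  obtain b x where p: "p = (b, x)" by (cases p)
  have "image_mset snd Q = add_mset x (image_mset snd P)" using add.prems p by simp
  then obtain q Q' where Q: "Q = add_mset q Q'" "snd q = x" "image_mset snd Q' = image_mset snd P"
    using msed_map_invR by metis
  obtain E where E: "image_mset (\<lambda>((b, b'), x). (b, x)) E = P" "image_mset (\<lambda>((b, b'), x). (b', x)) E = Q'"
    using add.IH[of Q'] Q(3) by auto
  show ?case
    by (rule exI[of _ "add_mset ((b, fst q), x) E"]) (use E Q p in auto)
qed

lemma slices:
  assumes "\<And>a b x. ((a, b), x) \<in># t \<Longrightarrow> a = 1 \<or> a = 2"
  shows "\<exists>t1 t2. t = image_mset (\<lambda>(b, x). ((1, b), x)) t1 + image_mset (\<lambda>(b, x). ((2, b), x)) t2"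
  using assms
proof (induction t)
  case (add y t)
  obtain a b x where y: "y = ((a, b), x)" by (metis surj_pair)
  obtain t1 t2 where t: "t = image_mset (\<lambda>(b, x). ((1, b), x)) t1 + image_mset (\<lambda>(b, x). ((2, b), x)) t2"
    using add by (metis insert_iff set_mset_add_mset_insert)
  show ?case
  proof (cases "a = 1")
    case True
    show ?thesis
      by (rule exI[of _ "add_mset (b, x) t1"], rule exI[of _ t2]) (simp add: t y True)
  next
    case False
    then have "a = 2" using add.prems[of a b x] y by simp
    then show ?thesis
      by (intro exI[of _ t1] exI[of _ "add_mset (b, x) t2"]) (simp add: t y)
  qed
qed auto

text \<open>The layers \<open>a = 1\<close> of the two tables have the same \<open>x\<close>-marginal, so the entries \<open>P\<close> and \<open>Q\<close>
  in which these layers differ can be matched at equal \<open>x\<close>. The sum of the two layers is the same in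
  both tables, so the layers \<open>a = 2\<close> differ by the opposite change; as \<open>P\<close> and \<open>Q\<close> are disjoint,
  the layer \<open>a = 2\<close> of \<open>t\<close> does contain \<open>Q\<close>.\<close>

lemma tables_differ_by_exchanges:
  assumes "\<And>a b x. ((a, b), x) \<in># t \<Longrightarrow> a = 1 \<or> a = 2" "\<And>a b x. ((a, b), x) \<in># t' \<Longrightarrow> a = 1 \<or> a = 2"
    and "marg1 t = marg1 t'" "marg2 t = marg2 t'"
  shows "\<exists>R E. t = R + removed E \<and> t' = R + inserted E"
proof -
  let ?s = "\<lambda>a :: nat. image_mset (\<lambda>(b :: nat, x :: nat). ((a, b), x))"
  obtain t1 t2 where t: "t = ?s 1 t1 + ?s 2 t2" using slices[of t] assms(1) by blast
  obtain t1' t2' where t': "t' = ?s 1 t1' + ?s 2 t2'" using slices[of t'] assms(2) by blast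
  have m1: "marg1 (?s a u) = image_mset (Pair a) (image_mset snd u)" for a u
    by (induction u) auto
  have m2: "marg2 (?s a u) = u" for a u by (induction u) auto
  have tot: "t1 + t2 = t1' + t2'" using assms(4) by (simp only: t t' image_mset_union m2)
  have "count (image_mset snd t1) x = count (image_mset snd t1') x" for x
    using arg_cong[OF assms(3), of "\<lambda>u. count u (1, x)"]
    by (simp only: t t' image_mset_union m1 count_union count_Pair) simp
  then have x1: "image_mset snd t1 = image_mset snd t1'" by (rule multiset_eqI)
  define I where "I = t1 \<inter># t1'"
  obtain P Q where P: "t1 = I + P" and Q: "t1' = I + Q" and dis: "P \<inter># Q = {#}"
  proof
    show "t1 = I + (t1 - t1')" "t1' = I + (t1' - t1)" by (auto simp: I_def multiset_eq_iff)
    show "(t1 - t1') \<inter># (t1' - t1) = {#}" by (auto simp: multiset_eq_iff)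
  qed
  have PQ: "P + t2 = Q + t2'" using tot by (simp add: P Q)
  have "Q \<subseteq># t2"
  proof (rule mset_subset_eqI)
    fix y
    have "min (count P y) (count Q y) = 0" using dis by (metis count_empty count_inter_mset inf_nat_def)
    moreover have "count P y + count t2 y = count Q y + count t2' y" using PQ by (metis count_union)
    ultimately show "count Q y \<le> count t2 y" by auto
  qed
  then obtain L where L: "t2 = Q + L" by (metis mset_subset_eq_exists_conv)
  then have L': "t2' = P + L" using PQ by (metis add_left_cancel union_lcomm)
  have "image_mset snd P = image_mset snd Q" using x1 by (simp add: P Q)
  then obtain E where E: "image_mset (\<lambda>((b, b'), x). (b, x)) E = P"
    "image_mset (\<lambda>((b, b'), x). (b', x)) E = Q"
    using matching_exists by blast
  have "removed E = ?s 1 P + ?s 2 Q" unfolding E[symmetric] by (induction E) (auto simp: removed_def)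
  moreover have "inserted E = ?s 1 Q + ?s 2 P" unfolding E[symmetric]
    by (induction E) (auto simp: inserted_def)
  ultimately show ?thesis
    by (intro exI[of _ "?s 1 I + ?s 2 L"] exI[of _ E]) (simp add: t t' P Q L L')
qed

section \<open>Connecting a fiber by bounded moves\<close>

text \<open>The fiber of \<open>v0\<close>. Values outside the index ranges are not excluded explicitly: they
  cannot occur, as they do not occur in the pair marginals of \<open>v0\<close>.\<close>

definition margins_class :: "nat set \<Rightarrow> (nat \<Rightarrow> nat) multiset \<Rightarrow> (nat \<Rightarrow> nat) multiset set" where
  "margins_class J v0 = {v. set_mset v \<subseteq> extensional ({1, 2} \<union> J) \<and>
     (\<forall>j\<in>J. image_mset (\<lambda>i. (i 1, i j)) v = image_mset (\<lambda>i. (i 1, i j)) v0 \<and>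
            image_mset (\<lambda>i. (i 2, i j)) v = image_mset (\<lambda>i. (i 2, i j)) v0)}"

lemma realizations_in_margins_class:
  assumes "v \<in> realizations J t"
  shows "v \<in> margins_class J v0 \<longleftrightarrow> (\<forall>j\<in>J. marg1 (t j) = image_mset (\<lambda>i. (i 1, i j)) v0 \<and>
    marg2 (t j) = image_mset (\<lambda>i. (i 2, i j)) v0)"
proof -
  have "image_mset (\<lambda>i. (i 1, i j)) v = marg1 (t j)" "image_mset (\<lambda>i. (i 2, i j)) v = marg2 (t j)"
    if "j \<in> J" for j
  proof -
    have t: "t j = image_mset (cell j) v" using assms that by (simp add: realizations_def)
    show "image_mset (\<lambda>i. (i 1, i j)) v = marg1 (t j)" "image_mset (\<lambda>i. (i 2, i j)) v = marg2 (t j)"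
      by (simp_all add: t multiset.map_comp comp_def cell_def)
  qed
  then show ?thesis using assms by (auto simp: margins_class_def realizations_def)
qed

lemma margins_class_pairs:
  assumes "v \<in> margins_class J v0" "j \<in> J" "i \<in># v"
  shows "\<exists>i'\<in>#v0. i 1 = i' 1 \<and> i j = i' j" "\<exists>i'\<in>#v0. i 2 = i' 2 \<and> i j = i' j"
proof -
  have "(i 1, i j) \<in># image_mset (\<lambda>i. (i 1, i j)) v" "(i 2, i j) \<in># image_mset (\<lambda>i. (i 2, i j)) v"
    using assms(3) by auto
  then have "(i 1, i j) \<in># image_mset (\<lambda>i. (i 1, i j)) v0" "(i 2, i j) \<in># image_mset (\<lambda>i. (i 2, i j)) v0"
    using assms(1,2) by (simp_all add: margins_class_def del: set_image_mset)
  then show "\<exists>i'\<in>#v0. i 1 = i' 1 \<and> i j = i' j" "\<exists>i'\<in>#v0. i 2 = i' 2 \<and> i j = i' j"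
    unfolding set_image_mset by blast+
qed

text \<open>The induction is on the number of exchanges that separate \<open>v\<close> from \<open>v'\<close>. In each step the
  bounded subflows select some of the exchanges for every \<open>j\<close>, with the same effect on the
  \<open>{1, 2}\<close>-marginal. Their result is again a consistent family of three-way tables, so it is
  realised by some \<open>w\<close> in the fiber. The constant \<open>C\<close> has to admit moves of two indices, which
  connect the tables with equal three-way marginals; the factor \<open>2\<close> in its other part is the
  number of cells that one exchange removes.\<close>

lemma exchanges_joined:
  assumes J: "finite J" "1 \<notin> J" "2 \<notin> J" "J \<noteq> {}" and B: "finite B"
    and C0: "\<forall>z. \<exists>g. \<forall>c. set_mset c \<subseteq> B \<times> B \<and> net c = z \<longrightarrow>
      (\<exists>f. f \<subseteq># c \<and> net f = g \<and> size f \<le> C0 \<and> (c \<noteq> {#} \<longrightarrow> f \<noteq> {#}))"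
    and keys: "\<And>u. u \<in> margins_class J v0 \<Longrightarrow> (\<lambda>i. (i 1, i 2)) ` set_mset u \<subseteq> {1, 2} \<times> B"
    and "v \<in> margins_class J v0" "v \<in> realizations J (\<lambda>j. R j + removed (E j))"
      "v' \<in> realizations J (\<lambda>j. R j + inserted (E j))"
    and C: "C = max 2 (2 * C0 * card ({1, 2 :: nat} \<times> B))"
  shows "joined (margins_class J v0) C v v'"
  using assms(8-10)
proof (induction "\<Sum>j\<in>J. size (E j)" arbitrary: v R E rule: less_induct)
  case less
  let ?F = "margins_class J v0" and ?K = "{1, 2 :: nat} \<times> B"
  have sub: "realizations J t \<subseteq> ?F" if "u \<in> realizations J t" "u \<in> ?F" for u t
    using that realizations_in_margins_class by blast
  have vF: "v \<in> ?F" and vr: "v \<in> realizations J (\<lambda>j. R j + removed (E j))"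
    and v'r: "v' \<in> realizations J (\<lambda>j. R j + inserted (E j))" by fact+
  show ?case
  proof (cases "\<forall>j\<in>J. E j = {#}")
    case True
    then have "v' \<in> realizations J (\<lambda>j. R j + removed (E j))"
      using v'r by (simp add: realizations_def removed_def inserted_def)
    then have "joined (realizations J (\<lambda>j. R j + removed (E j))) 2 v v'"
      using realizations_joined[OF J vr] by blast
    then show ?thesis by (rule joined_mono) (use sub vr vF in \<open>auto simp: C\<close>)
  next
    case False
    define c where "c j = image_mset fst (E j)" for j
    define T where "T = image_mset (\<lambda>i. (i 1, i 2)) v"
    define T' where "T' = image_mset (\<lambda>i. (i 1, i 2)) v'"
    have fst_tab: "image_mset fst (image_mset (cell j) u) = image_mset (\<lambda>i. (i 1, i 2)) u" for j u
      by (simp add: multiset.map_comp comp_def cell_def)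
    have T: "image_mset fst (R j) + image_mset fst (removed (E j)) = T"
      "image_mset fst (R j) + image_mset fst (inserted (E j)) = T'" if j: "j \<in> J" for j
    proof -
      have "image_mset (cell j) v = R j + removed (E j)" "image_mset (cell j) v' = R j + inserted (E j)"
        using vr v'r j by (auto simp: realizations_def)
      then show "image_mset fst (R j) + image_mset fst (removed (E j)) = T"
        "image_mset fst (R j) + image_mset fst (inserted (E j)) = T'"
        unfolding T_def T'_def fst_tab[of j, symmetric] by simp_all
    qed
    have netc: "net (c j) = (\<lambda>b. int (count T' (1, b)) - int (count T (1, b)))" if "j \<in> J" for j
    proof
      fix b
      show "net (c j) b = int (count T' (1, b)) - int (count T (1, b))"
        using count_keys_change[of "E j" 1 b] unfolding T[OF that, symmetric] c_def by simp
    qed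
    have cK: "set_mset (c j) \<subseteq> B \<times> B" if "j \<in> J" for j
    proof -
      have "set_mset (image_mset fst (removed (E j))) \<subseteq> set_mset T"
        unfolding T(1)[OF that, symmetric] by simp
      moreover have "set_mset T \<subseteq> ?K" using keys[OF vF] by (simp add: T_def)
      ultimately have "set_mset (image_mset fst (removed (E j))) \<subseteq> ?K" by blast
      then show ?thesis unfolding keys_removed c_def[symmetric] by force
    qed
    obtain g where g: "\<forall>c. set_mset c \<subseteq> B \<times> B \<and>
        net c = (\<lambda>b. int (count T' (1, b)) - int (count T (1, b))) \<longrightarrow>
        (\<exists>f. f \<subseteq># c \<and> net f = g \<and> size f \<le> C0 \<and> (c \<noteq> {#} \<longrightarrow> f \<noteq> {#}))"
      using C0[rule_format] by (rule exE)
    have "\<forall>j\<in>J. \<exists>f. f \<subseteq># c j \<and> net f = g \<and> size f \<le> C0 \<and> (c j \<noteq> {#} \<longrightarrow> f \<noteq> {#})"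
      using g[rule_format, OF conjI] netc cK by simp
    from bchoice[OF this] obtain f where f: "\<And>j. j \<in> J \<Longrightarrow> f j \<subseteq># c j" "\<And>j. j \<in> J \<Longrightarrow> net (f j) = g"
      "\<And>j. j \<in> J \<Longrightarrow> size (f j) \<le> C0" "\<And>j. j \<in> J \<Longrightarrow> c j \<noteq> {#} \<Longrightarrow> f j \<noteq> {#}" by blast
    have "\<exists>F H. E j = F + H \<and> image_mset fst F = f j" if "j \<in> J" for j
    proof -
      have "image_mset fst (E j) = f j + (c j - f j)" using f(1)[OF that] by (simp add: c_def)
      then show ?thesis using image_mset_eq_plusD by metis
    qed
    then obtain F H where FH: "\<And>j. j \<in> J \<Longrightarrow> E j = F j + H j" "\<And>j. j \<in> J \<Longrightarrow> image_mset fst (F j) = f j"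
      by metis
    let ?R = "\<lambda>j. R j + removed (H j)"
    have vr': "v \<in> realizations J (\<lambda>j. ?R j + removed (F j))"
      using vr FH(1) by (simp add: realizations_def removed_add ac_simps)
    have v'r': "v' \<in> realizations J (\<lambda>j. (R j + inserted (F j)) + inserted (H j))"
      using v'r FH(1) by (simp add: realizations_def inserted_add ac_simps)
    obtain j0 where j0: "j0 \<in> J" "f j0 \<noteq> {#}" using False f(4) by (auto simp: c_def)
    \<comment> \<open>After the selected exchanges the \<open>{1, 2}\<close>-marginal still does not depend on \<open>j\<close>.\<close>
    have "image_mset fst (?R j + inserted (F j)) = image_mset fst (?R j0 + inserted (F j0))"
      if j: "j \<in> J" for j
    proof (rule multiset_eqI)
      fix p :: "nat \<times> nat"
      obtain a b where p: "p = (a, b)" by (cases p)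
      have "int (count (image_mset fst (?R l + inserted (F l))) (a, b)) =
          int (count T (a, b)) + (if a = 1 then g b else if a = 2 then - g b else 0)"
        if l: "l \<in> J" for l
        using count_keys_change[of "F l" a b] f(2)[OF l] FH(1)[OF l]
        unfolding T(1)[OF l, symmetric] FH(2)[OF l] by (simp add: removed_add split: if_splits)
      from this[OF j] this[OF j0(1)]
      show "count (image_mset fst (?R j + inserted (F j))) p =
          count (image_mset fst (?R j0 + inserted (F j0))) p" unfolding p by linarith
    qed
    moreover have "size (removed (F j)) \<le> 2 * C0 \<and> size (inserted (F j)) = size (removed (F j))"
      if "j \<in> J" for j
      using f(3)[OF that] FH(2)[OF that]
      by (metis mult_le_mono2 size_image_mset size_inserted size_removed)
    moreover have "finite ?K" using B by simp
    ultimately obtain u w where u: "u \<in> realizations J (\<lambda>j. ?R j + removed (F j))"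
      and w: "w \<in> realizations J (\<lambda>j. ?R j + inserted (F j))" and uw: "move (2 * C0 * card ?K) u w"
      using lift_table_change[OF J vr', of "\<lambda>j. inserted (F j)" _ "2 * C0" ?K] keys[OF vF] by blast
    have uF: "u \<in> ?F" using sub[OF vr' vF] u by blast
    have wF: "w \<in> ?F"
      using uF realizations_in_margins_class[OF u] realizations_in_margins_class[OF w]
      by (simp add: marg1_inserted_eq marg2_inserted_eq)
    have "joined (realizations J (\<lambda>j. ?R j + removed (F j))) 2 v u"
      by (rule realizations_joined[OF J vr' u])
    then have "joined ?F C v u" by (rule joined_mono) (use sub vr' vF in \<open>auto simp: C\<close>)
    moreover have "joined ?F C u w"
      using joined_step[OF uF wF uw] by (rule joined_mono) (auto simp: C)
    moreover have "joined ?F C w v'"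
    proof (rule less.hyps[OF _ wF _ v'r'])
      show "w \<in> realizations J (\<lambda>j. R j + inserted (F j) + removed (H j))"
        using w by (simp add: ac_simps)
      have "size (H j) \<le> size (E j)" if "j \<in> J" for j using FH(1)[OF that] by simp
      moreover have "F j0 \<noteq> {#}" using FH(2)[OF j0(1)] j0(2) by auto
      then have "size (H j0) < size (E j0)"
        using FH(1)[OF j0(1)] by (simp add: nonempty_has_size[symmetric])
      ultimately show "(\<Sum>j\<in>J. size (H j)) < (\<Sum>j\<in>J. size (E j))"
        using J(1) j0(1) by (intro sum_strict_mono_ex1) auto
    qed
    ultimately show ?thesis by (meson joined_trans)
  qed
qed

lemma joined_by_bounded_moves:
  fixes B :: "nat set"
  assumes B: "finite B"
  shows "\<exists>C. \<forall>J v v0 v'. finite J \<and> 1 \<notin> J \<and> 2 \<notin> J \<and> J \<noteq> {} \<and>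
    (\<forall>i\<in>#v0. i 1 \<in> {1, 2} \<and> i 2 \<in> B) \<and> v \<in> margins_class J v0 \<and> v' \<in> margins_class J v0
    \<longrightarrow> joined (margins_class J v0) C v v'"
proof -
  obtain C0 where C0: "\<forall>z. \<exists>g. \<forall>c. set_mset c \<subseteq> B \<times> B \<and> net c = z \<longrightarrow>
      (\<exists>f. f \<subseteq># c \<and> net f = g \<and> size f \<le> C0 \<and> (c \<noteq> {#} \<longrightarrow> f \<noteq> {#}))"
    using bounded_subflow[OF B] by blast
  define C where "C = max 2 (2 * C0 * card ({1, 2 :: nat} \<times> B))"
  have main: "joined (margins_class J v0) C v v'"
    if J: "finite J" "1 \<notin> J" "2 \<notin> J" "J \<noteq> {}"
      and v0: "\<forall>i\<in>#v0. i 1 \<in> {1, 2} \<and> i 2 \<in> B"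
      and v: "v \<in> margins_class J v0" "v' \<in> margins_class J v0" for J v v0 v'
  proof -
    let ?F = "margins_class J v0"
    have keys: "(\<lambda>i. (i 1, i 2)) ` set_mset u \<subseteq> {1, 2} \<times> B" if u: "u \<in> ?F" for u
    proof -
      obtain j where j: "j \<in> J" using J by blast
      have "i 1 \<in> {1, 2} \<and> i 2 \<in> B" if "i \<in># u" for i
        using margins_class_pairs[OF u j that] v0 by metis
      then show ?thesis by blast
    qed
    have "\<exists>R E. image_mset (cell j) v = R + removed E \<and> image_mset (cell j) v' = R + inserted E"
      if j: "j \<in> J" for j
    proof (rule tables_differ_by_exchanges)
      have a: "a = 1 \<or> a = 2" if "((a, b), x) \<in># image_mset (cell j) u" "u \<in> ?F" for a b x u
        using keys[OF that(2)] that(1) by (force simp: cell_def)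
      show "\<And>a b x. ((a, b), x) \<in># image_mset (cell j) v \<Longrightarrow> a = 1 \<or> a = 2"
        "\<And>a b x. ((a, b), x) \<in># image_mset (cell j) v' \<Longrightarrow> a = 1 \<or> a = 2" using a v by blast+
      have "marg1 (image_mset (cell j) u) = image_mset (\<lambda>i. (i 1, i j)) u"
        "marg2 (image_mset (cell j) u) = image_mset (\<lambda>i. (i 2, i j)) u" for u
        by (simp_all add: multiset.map_comp comp_def cell_def)
      then show "marg1 (image_mset (cell j) v) = marg1 (image_mset (cell j) v')"
        "marg2 (image_mset (cell j) v) = marg2 (image_mset (cell j) v')"
        using v j by (auto simp: margins_class_def)
    qed
    then obtain R E where RE: "\<And>j. j \<in> J \<Longrightarrow> image_mset (cell j) v = R j + removed (E j)"
      "\<And>j. j \<in> J \<Longrightarrow> image_mset (cell j) v' = R j + inserted (E j)" by metis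
    have "v \<in> realizations J (\<lambda>j. R j + removed (E j))"
      "v' \<in> realizations J (\<lambda>j. R j + inserted (E j))"
      using RE v by (auto simp: realizations_def margins_class_def)
    then show ?thesis using exchanges_joined[OF J B C0 keys v(1) _ _ C_def] by blast
  qed
  show ?thesis
  proof (intro exI[of _ C] allI impI)
    fix J :: "nat set" and v v0 v'
    assume "finite J \<and> 1 \<notin> J \<and> 2 \<notin> J \<and> J \<noteq> {} \<and>
      (\<forall>i\<in>#v0. i 1 \<in> {1, 2} \<and> i 2 \<in> B) \<and> v \<in> margins_class J v0 \<and> v' \<in> margins_class J v0"
    then show "joined (margins_class J v0) C v v'" by (intro main) simp_all
  qed
qed

section \<open>From multisets to integer vectors\<close>

definition vec :: "'i multiset \<Rightarrow> 'i \<Rightarrow> int" where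
  "vec m = (\<lambda>i. int (count m i))"

lemma nonneg_vectors_eq_vec:
  assumes "finite D"
  shows "nonneg_vectors D = vec ` {m. set_mset m \<subseteq> D}"
proof (intro equalityI subsetI)
  fix v :: "'a \<Rightarrow> int" assume v: "v \<in> nonneg_vectors D"
  define m where "m = (\<Sum>i\<in>D. replicate_mset (nat (v i)) i)"
  have m: "count m i = (if i \<in> D then nat (v i) else 0)" for i
    using assms by (simp add: m_def count_sum sum.delta')
  then have "vec m = v" using v by (auto simp: vec_def nonneg_vectors_def int_vectors_def fun_eq_iff)
  moreover have "set_mset m \<subseteq> D" using m by (metis count_eq_zero_iff subsetI)
  ultimately show "v \<in> vec ` {m. set_mset m \<subseteq> D}" by blast
next
  fix v :: "'a \<Rightarrow> int" assume "v \<in> vec ` {m. set_mset m \<subseteq> D}"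
  then show "v \<in> nonneg_vectors D"
    by (auto simp: vec_def nonneg_vectors_def int_vectors_def count_eq_zero_iff)
qed

lemma sum_count_filter:
  assumes "finite D" "set_mset m \<subseteq> D"
  shows "(\<Sum>c\<in>D. (if P c then 1 else 0) * int (count m c)) = int (size (filter_mset P m))"
  using assms(2)
proof (induction m)
  case (add x m)
  have "(\<Sum>c\<in>D. (if P c then 1 else 0) * int (count (add_mset x m) c)) =
     (\<Sum>c\<in>D. (if P c then 1 else 0) * int (count m c) + (if c = x then (if P c then 1 else 0) else 0))"
    by (rule sum.cong) auto
  also have "\<dots> = (\<Sum>c\<in>D. (if P c then 1 else 0) * int (count m c)) + (if P x then 1 else 0)"
    using assms(1) add.prems by (simp add: sum.distrib)
  finally show ?case using add by auto
qed simp

lemma count_image_filter: "count (image_mset f m) a = size (filter_mset (\<lambda>i. f i = a) m)"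
  by (induction m) auto

lemma finite_multi_indices: "finite V \<Longrightarrow> finite (multi_indices d V)"
  by (simp add: multi_indices_def finite_PiE)

lemma mat_apply_vec:
  assumes "finite V" "set_mset m \<subseteq> multi_indices d V" "\<And>F. F \<in> facets \<Gamma> \<Longrightarrow> F \<subseteq> V"
  shows "mat_apply (marginal_matrix V \<Gamma> d) (vec m) (F, a) =
    (if F \<in> facets \<Gamma> then int (count (image_mset (\<lambda>i. restrict i F) m) a) else 0)"
proof -
  have "count (image_mset (\<lambda>i. restrict i F) m) a = 0"
    if F: "F \<in> facets \<Gamma>" and a: "a \<notin> multi_indices d F"
  proof -
    have "restrict i F \<in> multi_indices d F" if "i \<in># m" for i
    proof -
      have "i \<in> multi_indices d V" "F \<subseteq> V" using that assms(2,3) F by blast+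
      then show ?thesis unfolding multi_indices_def by (auto simp: PiE_iff)
    qed
    then show ?thesis using a by (auto simp: count_eq_zero_iff)
  qed
  then show ?thesis
    using sum_count_filter[OF finite_multi_indices[OF assms(1)] assms(2)]
    by (auto simp: mat_apply_def marginal_matrix_def vec_def count_image_filter)
qed

lemma same_fiber_iff:
  assumes "finite V" "set_mset m \<subseteq> multi_indices d V" "set_mset m' \<subseteq> multi_indices d V"
    and "\<And>F. F \<in> facets \<Gamma> \<Longrightarrow> F \<subseteq> V"
  shows "mat_apply (marginal_matrix V \<Gamma> d) (vec m) = mat_apply (marginal_matrix V \<Gamma> d) (vec m') \<longleftrightarrow>
    (\<forall>F\<in>facets \<Gamma>. image_mset (\<lambda>i. restrict i F) m = image_mset (\<lambda>i. restrict i F) m')"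
  using mat_apply_vec[OF assms(1,2,4)] mat_apply_vec[OF assms(1,3,4)]
  by (auto simp: fun_eq_iff multiset_eq_iff)

lemma image_restrict_pair_eq_iff:
  assumes "a \<noteq> b"
  shows "image_mset (\<lambda>i. restrict i {a, b}) m = image_mset (\<lambda>i. restrict i {a, b}) m' \<longleftrightarrow>
    image_mset (\<lambda>i. (i a, i b)) m = image_mset (\<lambda>i. (i a, i b)) m'"
proof
  assume "image_mset (\<lambda>i. restrict i {a, b}) m = image_mset (\<lambda>i. restrict i {a, b}) m'"
  from arg_cong[OF this, of "image_mset (\<lambda>f. (f a, f b))"]
  show "image_mset (\<lambda>i. (i a, i b)) m = image_mset (\<lambda>i. (i a, i b)) m'"
    by (simp add: multiset.map_comp comp_def)
next
  have r: "restrict i {a, b} = (\<lambda>(x, y). restrict (\<lambda>t. if t = a then x else y) {a, b}) (i a, i b)"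
    for i :: "'a \<Rightarrow> 'b" using assms by (auto simp: restrict_def)
  assume "image_mset (\<lambda>i. (i a, i b)) m = image_mset (\<lambda>i. (i a, i b)) m'"
  from arg_cong[OF this, of "image_mset (\<lambda>(x, y). restrict (\<lambda>t. if t = a then x else y) {a, b})"]
  show "image_mset (\<lambda>i. restrict i {a, b}) m = image_mset (\<lambda>i. restrict i {a, b}) m'"
    by (simp only: multiset.map_comp comp_def r[symmetric])
qed

lemma vec_degree_move:
  assumes "finite D" "move C v v'"
  shows "vec_degree D (\<lambda>i. vec v i - vec v' i) \<le> C"
proof -
  obtain r w w' where v: "v = r + w" "v' = r + w'" "size w \<le> C" "size w' \<le> C"
    using assms(2) by (auto simp: move_def)
  have le: "norm1 D (\<lambda>i. max (int (count x i) - int (count y i)) 0) \<le> size x" for x y :: "'a multiset"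
  proof -
    have "norm1 D (\<lambda>i. max (int (count x i) - int (count y i)) 0) \<le> (\<Sum>i\<in>D. count x i)"
      unfolding norm1_def by (rule sum_mono) auto
    also have "\<dots> \<le> (\<Sum>i\<in>D \<union> set_mset x. count x i)"
      using assms(1) by (intro sum_mono2) auto
    also have "\<dots> = (\<Sum>i\<in>set_mset x. count x i)"
      using assms(1) by (intro sum.mono_neutral_right) (auto simp: count_eq_zero_iff)
    also have "\<dots> = size x" by (simp add: size_multiset_overloaded_eq)
    finally show ?thesis .
  qed
  show ?thesis using le[of w w'] le[of w' w] v(3,4) by (simp add: vec_degree_def vec_def v(1,2))
qed

text \<open>All integer vectors of degree at most \<open>C\<close> together form the Markov basis, which reduces
  the bound to the connectedness of the fibers under moves of that degree.\<close>

lemma mardeg_le: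
  assumes "finite (cols M)"
    and "\<And>m m'. set_mset m \<subseteq> cols M \<Longrightarrow> set_mset m' \<subseteq> cols M \<Longrightarrow>
      mat_apply M (vec m) = mat_apply M (vec m') \<Longrightarrow>
      joined {u. set_mset u \<subseteq> cols M \<and> mat_apply M (vec u) = mat_apply M (vec m)} C m m'"
  shows "mardeg M \<le> enat C"
proof -
  define B where "B = {z \<in> int_vectors (cols M). vec_degree (cols M) z \<le> C}"
  have "markov_basis M B"
    unfolding markov_basis_def
  proof (intro conjI ballI)
    fix b u v assume "u \<in> fiber M b" "v \<in> fiber M b"
    then obtain m m' where m: "u = vec m" "set_mset m \<subseteq> cols M" "mat_apply M (vec m) = b"
      and m': "v = vec m'" "set_mset m' \<subseteq> cols M" "mat_apply M (vec m') = b"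
      unfolding fiber_def nonneg_vectors_eq_vec[OF assms(1)] by auto
    let ?F = "{u. set_mset u \<subseteq> cols M \<and> mat_apply M (vec u) = b}"
    have "joined ?F C m m'" using assms(2)[OF m(2) m'(2)] m(3) m'(3) by simp
    then have "(vec m, vec m') \<in> (fiber_graph M B b)\<^sup>*"
      unfolding joined_def
    proof (induction rule: rtranclp_induct)
      case (step y z)
      have fib: "vec y \<in> fiber M b" "vec z \<in> fiber M b"
        using step(2) by (auto simp: fiber_def nonneg_vectors_eq_vec[OF assms(1)])
      then have "(\<lambda>c. vec y c - vec z c) \<in> int_vectors (cols M)"
        by (auto simp: fiber_def nonneg_vectors_def int_vectors_def)
      then have "(\<lambda>c. vec y c - vec z c) \<in> B"
        using vec_degree_move[OF assms(1)] step(2) by (auto simp: B_def)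
      then have "(vec y, vec z) \<in> fiber_graph M B b" using fib by (simp add: fiber_graph_def)
      then show ?case using step.IH by simp
    qed simp
    then show "(u, v) \<in> (fiber_graph M B b)\<^sup>*" by (simp add: m m')
  qed (auto simp: B_def)
  then have "mardeg M \<le> set_degree (cols M) B" unfolding mardeg_def by (auto intro: INF_lower)
  also have "\<dots> \<le> enat C" unfolding set_degree_def by (auto intro!: SUP_least simp: B_def)
  finally show ?thesis .
qed

lemma ball_Collect_pairs:
  "(\<forall>F\<in>{f i j |i j. i \<in> A \<and> j \<in> B}. P F) \<longleftrightarrow> (\<forall>i\<in>A. \<forall>j\<in>B. P (f i j))"
  by blast

theorem corollary55:
  fixes k :: nat
  shows "\<exists>C::nat. \<forall>N::nat. \<forall>d::nat \<Rightarrow> nat.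
    N \<ge> 1 \<and> (\<forall>j\<in>K2_verts N. d j \<ge> 2) \<and> d 1 = 2 \<and> d 2 = k \<longrightarrow>
      mardeg (marginal_matrix (K2_verts N) (K2_complex N) d) \<le> enat C"
proof -
  obtain C where *: "\<forall>J v v0 v'. finite J \<and> 1 \<notin> J \<and> 2 \<notin> J \<and> J \<noteq> {} \<and>
    (\<forall>i\<in>#v0. i 1 \<in> {1, 2} \<and> i 2 \<in> {1..k}) \<and> v \<in> margins_class J v0 \<and> v' \<in> margins_class J v0
    \<longrightarrow> joined (margins_class J v0) C v v'"
    using joined_by_bounded_moves[OF finite_atLeastAtMost] by (rule exE)
  have main: "mardeg (marginal_matrix (K2_verts N) (K2_complex N) d) \<le> enat C"
    if N: "N \<ge> 1" and d: "\<forall>j\<in>K2_verts N. d j \<ge> 2" "d 1 = 2" "d 2 = k" for N d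
  proof (rule mardeg_le)
    let ?V = "K2_verts N" and ?M = "marginal_matrix (K2_verts N) (K2_complex N) d"
    let ?J = "{3..N + 2}"
    have V: "?V = {1, 2} \<union> ?J" "finite ?V" using N by (auto simp: K2_verts_def)
    have cols: "cols ?M = multi_indices d ?V" by (simp add: marginal_matrix_def)
    show "finite (cols ?M)" using V(2) by (simp add: cols finite_multi_indices)
    have facets: "facets (K2_complex N) = K2_edges N" using N by (rule facets_K2_complex)
    have sub: "F \<subseteq> ?V" if "F \<in> facets (K2_complex N)" for F
      using that N unfolding facets by (auto simp: K2_edges_def K2_verts_def)
    have same: "mat_apply ?M (vec m) = mat_apply ?M (vec m') \<longleftrightarrow>
      (\<forall>j\<in>?J. image_mset (\<lambda>i. (i 1, i j)) m = image_mset (\<lambda>i. (i 1, i j)) m' \<and>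
            image_mset (\<lambda>i. (i 2, i j)) m = image_mset (\<lambda>i. (i 2, i j)) m')"
      if "set_mset m \<subseteq> cols ?M" "set_mset m' \<subseteq> cols ?M" for m m'
    proof -
      have "mat_apply ?M (vec m) = mat_apply ?M (vec m') \<longleftrightarrow>
        (\<forall>F\<in>K2_edges N. image_mset (\<lambda>i. restrict i F) m = image_mset (\<lambda>i. restrict i F) m')"
        unfolding facets[symmetric] using that
        by (intro same_fiber_iff V(2) sub) (simp_all add: cols)
      also have "\<dots> \<longleftrightarrow> (\<forall>a\<in>{1, 2}. \<forall>j\<in>?J. image_mset (\<lambda>i. restrict i {a, j}) m =
          image_mset (\<lambda>i. restrict i {a, j}) m')"
        unfolding K2_edges_def by (rule ball_Collect_pairs)
      also have "\<dots> \<longleftrightarrow> (\<forall>a\<in>{1, 2}. \<forall>j\<in>?J. image_mset (\<lambda>i. (i a, i j)) m = image_mset (\<lambda>i. (i a, i j)) m')"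
        by (intro ball_cong refl image_restrict_pair_eq_iff) auto
      finally show ?thesis by auto
    qed
    fix m m' :: "(nat \<Rightarrow> nat) multiset"
    assume m: "set_mset m \<subseteq> cols ?M" "set_mset m' \<subseteq> cols ?M"
      and eq: "mat_apply ?M (vec m) = mat_apply ?M (vec m')"
    have in_class: "u \<in> margins_class ?J m"
      if "set_mset u \<subseteq> cols ?M" "mat_apply ?M (vec u) = mat_apply ?M (vec m)" for u
    proof -
      have "set_mset u \<subseteq> extensional ({1, 2} \<union> ?J)"
        using that(1) unfolding cols V(1)[symmetric] by (auto simp: multi_indices_def PiE_def)
      then show ?thesis using same[OF that(1) m(1)] that(2) by (simp add: margins_class_def)
    qed
    have ranges: "i 1 \<in> {1, 2} \<and> i 2 \<in> {1..k}" if "i \<in># m" for i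
    proof -
      have "i \<in> multi_indices d ?V" using m(1) that unfolding cols by blast
      then have "i 1 \<in> {1..d 1}" "i 2 \<in> {1..d 2}"
        unfolding multi_indices_def V(1) PiE_iff by blast+
      then show ?thesis using d(2,3) by auto
    qed
    have in_cols: "set_mset u \<subseteq> cols ?M" if u: "u \<in> margins_class ?J m" for u
    proof
      fix i assume i: "i \<in># u"
      have agree: "\<exists>i'\<in>#m. i 1 = i' 1 \<and> i j = i' j"
        "\<exists>i'\<in>#m. i 2 = i' 2 \<and> i j = i' j" if "j \<in> ?J" for j
        using margins_class_pairs[OF u that i] by blast+
      have "3 \<in> ?J" using N by simp
      have "i j \<in> {1..d j}" if j: "j \<in> ?V" for j
      proof -
        consider "j = 1" | "j = 2" | "j \<in> ?J" using j unfolding V(1) by blast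
        then have "\<exists>i'\<in>#m. i j = i' j"
          by cases (use agree[OF \<open>3 \<in> ?J\<close>] agree(1)[of j] in blast)+
        then obtain i' where "i' \<in># m" "i j = i' j" by blast
        moreover from this have "i' \<in> multi_indices d ?V" using m(1) unfolding cols by blast
        ultimately show ?thesis using j unfolding multi_indices_def PiE_iff by simp
      qed
      moreover have "i \<in> extensional ?V" using u i unfolding V(1) by (auto simp: margins_class_def)
      ultimately show "i \<in> cols ?M" unfolding cols multi_indices_def PiE_iff by blast
    qed
    have "joined (margins_class ?J m) C m m'"
      using in_class[OF m(1) refl] in_class[OF m(2) eq[symmetric]] ranges N
      by (intro *[rule_format] conjI) auto
    moreover have "margins_class ?J m \<subseteq>
        {u. set_mset u \<subseteq> cols ?M \<and> mat_apply ?M (vec u) = mat_apply ?M (vec m)}"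
    proof
      fix u assume u: "u \<in> margins_class ?J m"
      then have "mat_apply ?M (vec u) = mat_apply ?M (vec m)"
        using same[OF in_cols[OF u] m(1)] by (simp add: margins_class_def)
      then show "u \<in> {u. set_mset u \<subseteq> cols ?M \<and> mat_apply ?M (vec u) = mat_apply ?M (vec m)}"
        using in_cols[OF u] by simp
    qed
    ultimately show "joined {u. set_mset u \<subseteq> cols ?M \<and> mat_apply ?M (vec u) = mat_apply ?M (vec m)} C m m'"
      by (rule joined_mono) simp
  qed
  show ?thesis
  proof (intro exI[of _ C] allI impI)
    fix N and d :: "nat \<Rightarrow> nat"
    assume "N \<ge> 1 \<and> (\<forall>j\<in>K2_verts N. d j \<ge> 2) \<and> d 1 = 2 \<and> d 2 = k"
    then show "mardeg (marginal_matrix (K2_verts N) (K2_complex N) d) \<le> enat C"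
      by (intro main) simp_all
  qed
qed

end
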